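(* Let $m=m(n)$ and $k=k(n)$ be positive integer sequences with $n\ll m\ll n^2/\log^2 n$, and let $(j_n)$ be any sequence of positive integers with $j_n\leq n-k$. For each $n$, let $\boldsymbol{\sigma}_{n,m}$ be a permutation chosen uniformly at random from the set of permutations of $[n]$ with exactly $m$ inversions. Then \[\lim_{n\to\infty}\mathbb{P}\big(\boldsymbol{\sigma}_{n,m}(j_n)>\boldsymbol{\sigma}_{n,m}(j_n+k)\big)=\begin{cases}\tfrac12 & \text{if } k\ll m/n,\\ 0 & \text{if } k\gg m/n.\end{cases}\]
   Context: A permutation of length $n$ is a linear ordering $\sigma(1)\ldots\sigma(n)$ of $[n]$; an inversion is a pair $i<j$ with $\sigma(i)>\sigma(j)$. For sequences, $f\ll g$ (equivalently $g\gg f$) means $f/g\to0$ as $n\to\infty$. *)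

theory Defs
  imports "HOL-Probability.Probability" "HOL-Combinatorics.Permutations"
begin

definition much_less :: "(nat \<Rightarrow> real) \<Rightarrow> (nat \<Rightarrow> real) \<Rightarrow> bool"
    (infix \<open>\<lless>\<close> 50) where
  "f \<lless> g \<longleftrightarrow> (\<lambda>n. f n / g n) \<longlonglongrightarrow> 0"

definition inversions :: "nat \<Rightarrow> (nat \<Rightarrow> nat) \<Rightarrow> (nat \<times> nat) set" where
  "inversions n \<sigma> = {(i, j). i \<in> {1..n} \<and> j \<in> {1..n} \<and> i < j \<and> \<sigma> i > \<sigma> j}"

definition perms_inv :: "nat \<Rightarrow> nat \<Rightarrow> (nat \<Rightarrow> nat) set" where
  "perms_inv n m = {\<sigma>. \<sigma> permutes {1..n} \<and> card (inversions n \<sigma>) = m}"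

text \<open>
  Meaningful only if \<^term>\<open>perms_inv n m\<close> is nonempty, i.e. if \<open>m \<le> n (n - 1) / 2\<close>;
  otherwise \<^const>\<open>pmf_of_set\<close> is unspecified.
\<close>
definition random_perm :: "nat \<Rightarrow> nat \<Rightarrow> (nat \<Rightarrow> nat) pmf" where
  "random_perm n m = pmf_of_set (perms_inv n m)"

end

theory Submission
  imports Defs
begin

text \<open>
  A permutation of \<open>[n]\<close> with \<open>m\<close> inversions is encoded by its Lehmer code, a sequence with
  \<open>0 \<le> e i < i\<close> and sum \<open>m\<close>, where \<open>e i\<close> counts the larger values to the left of position \<open>i\<close>.
  Moving mass between entries of a code and double counting shows that an entry is rarely much
  larger than \<open>m / n\<close>, and that two given entries rarely differ by much less than \<open>m / n\<close>.

  If positions \<open>i < j\<close> form an inversion, then \<open>e i < e j\<close>, and conversely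
  \<open>e i + (j - i) \<le> e j\<close> forces an inversion. For \<open>j - i\<close> much smaller than \<open>m / n\<close> the two
  conditions have nearly the same probability, which is close to \<open>1 / 2\<close> because the two entries
  can be exchanged unless one of them is exceptionally large; the symmetry under
  reverse-complement allows one to assume that \<open>i\<close> is of order \<open>n\<close>. For \<open>j - i\<close> much larger than
  \<open>m / n\<close>, every position between \<open>i\<close> and \<open>j\<close> is inverted with one of the two, so that an
  inversion makes an entry of the code of the permutation or of its reverse-complement large.
\<close>

subsection \<open>Comparing probabilities under uniform distributions\<close>

lemma prob_mono_on_set_pmf:
  assumes "\<And>x. x \<in> set_pmf p \<Longrightarrow> P x \<Longrightarrow> Q x"
  shows "measure_pmf.prob p {x. P x} \<le> measure_pmf.prob p {x. Q x}"
  using assms by (intro measure_pmf.finite_measure_mono_AE) (auto simp: AE_measure_pmf_iff)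

lemma prob_le_add:
  assumes "\<And>x. P x \<Longrightarrow> Q x \<or> R x"
  shows "measure_pmf.prob p {x. P x} \<le> measure_pmf.prob p {x. Q x} + measure_pmf.prob p {x. R x}"
proof -
  have "measure_pmf.prob p {x. P x} \<le> measure_pmf.prob p ({x. Q x} \<union> {x. R x})"
    using assms by (intro measure_pmf.finite_measure_mono) auto
  also have "\<dots> \<le> measure_pmf.prob p {x. Q x} + measure_pmf.prob p {x. R x}"
    by (intro measure_Un_le) auto
  finally show ?thesis .
qed

lemma prob_pmf_of_set_bij_betw:
  assumes "bij_betw f A B" "A \<noteq> {}" "finite A"
  shows "measure_pmf.prob (pmf_of_set A) {x. Q (f x)} = measure_pmf.prob (pmf_of_set B) {y. Q y}"
  using map_pmf_of_set_bij_betw[OF assms] measure_map_pmf[of f "pmf_of_set A" "{y. Q y}"]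
  by (simp add: vimage_def)

text \<open>
  The switching method: \<open>T x l\<close> modifies \<open>x\<close> at one of its marks \<open>l \<in> M x\<close>, and the result
  leaves only the marks in \<open>R (T x l)\<close> possible.
\<close>
lemma prob_pmf_of_set_switching_le:
  fixes s r :: real
  assumes C: "finite C" "C \<noteq> {}"
    and marks: "\<And>x. x \<in> C \<Longrightarrow> P x \<Longrightarrow> finite (M x) \<and> s \<le> card (M x)"
    and switch: "\<And>x l. x \<in> C \<Longrightarrow> P x \<Longrightarrow> l \<in> M x \<Longrightarrow> T x l \<in> C \<and> Q (T x l) \<and> l \<in> R (T x l)"
    and inj: "\<And>l. inj_on (\<lambda>x. T x l) {x \<in> C. P x \<and> l \<in> M x}"
    and traces: "\<And>y. y \<in> C \<Longrightarrow> Q y \<Longrightarrow> finite (R y) \<and> card (R y) \<le> r"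
  shows "measure_pmf.prob (pmf_of_set C) {x. P x} * s
    \<le> measure_pmf.prob (pmf_of_set C) {y. Q y} * r"
proof -
  let ?A = "{x \<in> C. P x}" and ?B = "{y \<in> C. Q y}"
  have "card ?A * s = (\<Sum>x\<in>?A. s)" by simp
  also have "\<dots> \<le> (\<Sum>x\<in>?A. real (card (M x)))"
    using marks by (intro sum_mono) auto
  also have "\<dots> = card (Sigma ?A M)"
    using C marks by (subst card_SigmaI) auto
  also have "\<dots> \<le> card (Sigma ?B R)"
  proof -
    have "inj_on (\<lambda>(x, l). (T x l, l)) (Sigma ?A M)"
      using inj by (force simp: inj_on_def)
    moreover have "(\<lambda>(x, l). (T x l, l)) ` Sigma ?A M \<subseteq> Sigma ?B R"
      using switch by auto
    moreover have "finite (Sigma ?B R)"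
      using C traces by auto
    ultimately show ?thesis by (intro of_nat_mono card_inj_on_le)
  qed
  also have "\<dots> = (\<Sum>y\<in>?B. real (card (R y)))"
    using C traces by (subst card_SigmaI) auto
  also have "\<dots> \<le> (\<Sum>y\<in>?B. r)"
    using traces by (intro sum_mono) auto
  also have "\<dots> = card ?B * r" by simp
  finally have "card ?A * s / card C \<le> card ?B * r / card C"
    by (intro divide_right_mono) auto
  then show ?thesis
    using C by (simp add: measure_pmf_of_set Int_def)
qed

subsection \<open>Random compositions with bounded parts\<close>

definition bounded_compositions :: "'a set \<Rightarrow> ('a \<Rightarrow> nat) \<Rightarrow> nat \<Rightarrow> ('a \<Rightarrow> nat) set" where
  "bounded_compositions I c m = {e \<in> (\<Pi>\<^sub>E i\<in>I. {..<c i}). sum e I = m}"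

abbreviation random_composition :: "'a set \<Rightarrow> ('a \<Rightarrow> nat) \<Rightarrow> nat \<Rightarrow> ('a \<Rightarrow> nat) pmf" where
  "random_composition I c m \<equiv> pmf_of_set (bounded_compositions I c m)"

definition move :: "'a \<Rightarrow> 'a \<Rightarrow> nat \<Rightarrow> ('a \<Rightarrow> nat) \<Rightarrow> 'a \<Rightarrow> nat" where
  "move i a d e = e(i := e i - d, a := e a + d)"

lemma finite_bounded_compositions: "finite I \<Longrightarrow> finite (bounded_compositions I c m)"
  unfolding bounded_compositions_def by (simp add: finite_PiE)

lemma bounded_compositions_less:
  "e \<in> bounded_compositions I c m \<Longrightarrow> i \<in> I \<Longrightarrow> e i < c i"
  by (simp add: bounded_compositions_def PiE_iff)

lemma sum_bounded_compositions: "e \<in> bounded_compositions I c m \<Longrightarrow> sum e I = m"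
  by (simp add: bounded_compositions_def)

lemma sum_fun_upd:
  fixes f :: "'a \<Rightarrow> 'b::comm_monoid_add"
  assumes "finite I" "i \<in> I"
  shows "sum (f(i := v)) I + f i = sum f I + v"
proof -
  have "sum (f(i := v)) (I - {i}) = sum f (I - {i})"
    by (intro sum.cong) auto
  then show ?thesis
    using assms by (simp add: sum.remove[of I i] ac_simps)
qed

lemma bounded_compositions_nonempty:
  assumes "finite I" "\<And>i. i \<in> I \<Longrightarrow> 0 < c i" "m \<le> (\<Sum>i\<in>I. c i - 1)"
  shows "bounded_compositions I c m \<noteq> {}"
  using assms(3)
proof (induction m)
  case 0
  have "(\<lambda>i\<in>I. 0) \<in> bounded_compositions I c 0"
    using assms(2) by (auto simp: bounded_compositions_def)
  then show ?case by blast
next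
  case (Suc m)
  then obtain e where e: "e \<in> bounded_compositions I c m" by fastforce
  obtain i where i: "i \<in> I" "e i < c i - 1"
  proof (rule ccontr)
    assume "\<not> thesis"
    then have "(\<Sum>i\<in>I. c i - 1) \<le> sum e I"
      using that by (intro sum_mono) (meson not_le)
    then show False using Suc.prems sum_bounded_compositions[OF e] by simp
  qed
  have "e(i := Suc (e i)) \<in> bounded_compositions I c (Suc m)"
    using e i sum_fun_upd[OF \<open>finite I\<close> i(1), of e "Suc (e i)"]
    by (auto simp: bounded_compositions_def PiE_iff extensional_def)
  then show ?case by blast
qed

lemma move_in_bounded_compositions:
  assumes "finite I" "e \<in> bounded_compositions I c m" "i \<in> I" "a \<in> I" "i \<noteq> a"
    and "d \<le> e i" "e a + d < c a"
  shows "move i a d e \<in> bounded_compositions I c m"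
proof -
  have "sum (move i a d e) I = sum e I"
    using assms sum_fun_upd[of I i e "e i - d"] sum_fun_upd[of I a "e(i := e i - d)" "e a + d"]
    by (simp add: move_def)
  then show ?thesis
    using assms by (auto simp: bounded_compositions_def PiE_iff extensional_def move_def
        intro: le_less_trans[OF diff_le_self])
qed

lemma move_move_back: "i \<noteq> a \<Longrightarrow> d \<le> e i \<Longrightarrow> move a i d (move i a d e) = e"
  by (auto simp: move_def)

lemma inj_on_move:
  assumes "\<And>e. e \<in> A \<Longrightarrow> i \<noteq> a \<and> d \<le> e i"
  shows "inj_on (move i a d) A"
  using assms by (intro inj_on_inverseI[where g = "move a i d"] move_move_back) auto

lemma transpose_in_bounded_compositions:
  assumes "e \<in> bounded_compositions I c m" "a \<in> I" "b \<in> I" "e a < c b" "e b < c a"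
  shows "e \<circ> Transposition.transpose a b \<in> bounded_compositions I c m"
proof -
  have "sum (e \<circ> Transposition.transpose a b) I = sum e I"
    using sum.permute[OF permutes_swap_id[OF assms(2,3)], of e] by simp
  moreover have "e \<circ> Transposition.transpose a b \<in> (\<Pi>\<^sub>E i\<in>I. {..<c i})"
    using assms
    by (auto simp: bounded_compositions_def PiE_iff extensional_def Transposition.transpose_def)
  ultimately show ?thesis
    using assms by (simp add: bounded_compositions_def)
qed

lemma inj_comp_transpose: "inj (\<lambda>e. e \<circ> Transposition.transpose a b)"
  by (rule inj_on_inverseI[where g = "\<lambda>e. e \<circ> Transposition.transpose a b"]) (simp add: comp_assoc)

lemma card_large_entries_mult_le:
  fixes e :: "'a \<Rightarrow> nat"
  assumes "finite I"
  shows "card {b \<in> I. t \<le> e b} * t \<le> sum e I"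
proof -
  have "card {b \<in> I. t \<le> e b} * t = (\<Sum>b\<in>{b \<in> I. t \<le> e b}. t)" by simp
  also have "\<dots> \<le> (\<Sum>b\<in>{b \<in> I. t \<le> e b}. e b)" by (intro sum_mono) auto
  also have "\<dots> \<le> sum e I" using assms by (intro sum_mono2) auto
  finally show ?thesis .
qed

lemma card_close_differences_le:
  "finite {d. d \<le> x \<and> \<bar>int (x - d) - int y\<bar> < int k}"
  "card {d. d \<le> x \<and> \<bar>int (x - d) - int y\<bar> < int k} \<le> 2 * k"
proof -
  let ?D = "{d. d \<le> x \<and> \<bar>int (x - d) - int y\<bar> < int k}"
  have sub: "?D \<subseteq> {x + 1 - y - k..<x + k - y}" by auto
  then show "finite ?D" by (rule finite_subset) simp
  show "card ?D \<le> 2 * k" using card_mono[OF _ sub] by simp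
qed

context
  fixes I :: "'a set" and c :: "'a \<Rightarrow> nat" and m :: nat
  assumes finite_I: "finite I" and nonempty: "bounded_compositions I c m \<noteq> {}"
begin

text \<open>
  An amount \<open>t\<close> is moved from entry \<open>i\<close> to another entry, which ends up being at least \<open>t\<close> and
  is therefore one of at most \<open>m / t\<close> entries.
\<close>
lemma prob_entry_ge_mult_le:
  assumes i: "i \<in> I" and t: "0 < t"
  shows "measure_pmf.prob (random_composition I c m) {e. t \<le> e i}
    * (real t * real (card {b \<in> I. 2 * t \<le> c b}) - real m) \<le> real m"
proof -
  let ?C = "bounded_compositions I c m" and ?J = "{b \<in> I. 2 * t \<le> c b}"
  let ?large = "\<lambda>e::'a \<Rightarrow> nat. {b \<in> I. t \<le> e b}"
  have card_large: "card (?large e) \<le> m / t" if "e \<in> ?C" for e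
    using card_large_entries_mult_le[OF finite_I, of t e] t
    by (simp add: sum_bounded_compositions[OF that] pos_le_divide_eq flip: of_nat_mult)
  have "measure_pmf.prob (pmf_of_set ?C) {e. t \<le> e i} * ((t * real (card ?J) - m) / t)
    \<le> measure_pmf.prob (pmf_of_set ?C) {e. True} * (m / t)"
  proof (rule prob_pmf_of_set_switching_le[where M = "\<lambda>e. ?J - ?large e"
        and T = "\<lambda>e b. move i b t e" and R = ?large])
    fix e assume e: "e \<in> ?C"
    have "card ?J \<le> card (?J - ?large e) + card (?large e)"
      using diff_card_le_card_Diff[of "?large e" ?J] finite_I by simp
    then show "finite (?J - ?large e) \<and> (t * real (card ?J) - m) / t \<le> card (?J - ?large e)"
      using card_large[OF e] finite_I t by (simp add: diff_divide_distrib)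
  next
    fix e b assume "e \<in> ?C" "t \<le> e i" "b \<in> ?J - ?large e"
    then have "move i b t e \<in> ?C"
      using finite_I i by (intro move_in_bounded_compositions) auto
    then show "move i b t e \<in> ?C \<and> True \<and> b \<in> ?large (move i b t e)"
      using \<open>b \<in> ?J - ?large e\<close> by (simp add: move_def)
  next
    fix b
    show "inj_on (move i b t) {e \<in> ?C. t \<le> e i \<and> b \<in> ?J - ?large e}"
      by (rule inj_on_move) (use i in auto)
  qed (use card_large nonempty finite_bounded_compositions[OF finite_I] finite_I in auto)
  then show ?thesis
    using t by (simp add: divide_le_cancel)
qed

lemma sum_capped_entries_ge:
  assumes e: "e \<in> bounded_compositions I c m" and ab: "a \<in> I" "b \<in> I" "a \<noteq> b"
    and c_le: "\<And>i. i \<in> I \<Longrightarrow> c i \<le> K" and h: "h \<le> K"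
  shows "real h * (real m - 2 * real K) \<le> real K * real (\<Sum>i\<in>I - {a, b}. min (e i) h)"
proof -
  have e_less: "e i < K" if "i \<in> I" for i
    using bounded_compositions_less[OF e that] c_le[OF that] by simp
  have "m = e a + e b + sum e (I - {a, b})"
    using finite_I ab sum.subset_diff[of "{a, b}" I e] sum_bounded_compositions[OF e] by simp
  then have "real m - 2 * real K \<le> sum e (I - {a, b})"
    using e_less[OF ab(1)] e_less[OF ab(2)] by linarith
  then have "h * (real m - 2 * real K) \<le> real (h * sum e (I - {a, b}))"
    by (simp add: mult_left_mono)
  also have "h * sum e (I - {a, b}) \<le> K * (\<Sum>i\<in>I - {a, b}. min (e i) h)"
    unfolding sum_distrib_left
  proof (rule sum_mono)
    fix i assume "i \<in> I - {a, b}"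
    then show "h * e i \<le> K * min (e i) h"
      using e_less[of i] h by (auto simp: min_def mult.commute[of h] intro: mult_right_mono)
  qed
  finally show ?thesis by simp
qed

text \<open>
  A variable amount \<open>d\<close> is moved from a third entry to entry \<open>a\<close>. There are at least
  \<open>h (m - 2 K) / K\<close> choices for such a move, whereas its outcome leaves at most \<open>2 k\<close> choices for
  \<open>d\<close> and \<open>card I\<close> for the third entry. Capping \<open>d\<close> at \<open>h\<close> keeps entry \<open>a\<close> below its bound.
\<close>
lemma prob_entries_close_mult_le:
  assumes ab: "a \<in> I" "b \<in> I" "a \<noteq> b"
    and c_le: "\<And>i. i \<in> I \<Longrightarrow> c i \<le> K" and h: "2 * h \<le> c a"
  shows "measure_pmf.prob (random_composition I c m) {e. e a < h \<and> \<bar>int (e a) - int (e b)\<bar> < int k}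
    * (real h * (real m - 2 * real K)) \<le> 2 * real k * real (card I) * real K"
proof -
  let ?C = "bounded_compositions I c m"
  let ?close = "\<lambda>e. e a < h \<and> \<bar>int (e a) - int (e b)\<bar> < int k"
  let ?moves = "\<lambda>e. SIGMA i:I - {a, b}. {1..min (e i) h}"
  let ?amounts = "\<lambda>f. {d. d \<le> f a \<and> \<bar>int (f a - d) - int (f b)\<bar> < int k}"
  have K: "h \<le> K" "0 < K"
    using h c_le[OF ab(1)] bounded_compositions_less[OF _ ab(1), of _ c m] nonempty by fastforce+
  have "measure_pmf.prob (pmf_of_set ?C) {e. ?close e} * (h * (real m - 2 * K) / K)
    \<le> measure_pmf.prob (pmf_of_set ?C) {e. True} * (card I * (2 * k))"
  proof (rule prob_pmf_of_set_switching_le[where M = ?moves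
        and T = "\<lambda>e p. move (fst p) a (snd p) e" and R = "\<lambda>f. I \<times> ?amounts f"])
    fix e assume e: "e \<in> ?C"
    show "finite (?moves e) \<and> h * (real m - 2 * K) / K \<le> card (?moves e)"
      using sum_capped_entries_ge[OF e ab c_le K(1)] finite_I K
      by (simp add: pos_divide_le_eq mult.commute)
  next
    fix e p assume e: "e \<in> ?C" "?close e" and p: "p \<in> ?moves e"
    then have "move (fst p) a (snd p) e \<in> ?C"
      using ab h finite_I by (intro move_in_bounded_compositions) auto
    then show "move (fst p) a (snd p) e \<in> ?C \<and> True
        \<and> p \<in> I \<times> ?amounts (move (fst p) a (snd p) e)"
      using e p ab by (auto simp: move_def)
  next
    fix p
    show "inj_on (move (fst p) a (snd p)) {e \<in> ?C. ?close e \<and> p \<in> ?moves e}"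
      by (rule inj_on_move) auto
  next
    fix f
    show "finite (I \<times> ?amounts f) \<and> card (I \<times> ?amounts f) \<le> real (card I * (2 * k))"
      using finite_I card_close_differences_le
      by (simp add: card_cartesian_product flip: of_nat_mult)
  qed (use nonempty finite_bounded_compositions[OF finite_I] in auto)
  then show ?thesis
    using K by (simp add: field_simps)
qed

lemma prob_le_prob_transpose:
  assumes ab: "a \<in> I" "b \<in> I"
    and swap: "\<And>e. e \<in> bounded_compositions I c m \<Longrightarrow> P e \<Longrightarrow>
      e a < c b \<and> e b < c a \<and> Q (e \<circ> Transposition.transpose a b)"
  shows "measure_pmf.prob (random_composition I c m) {e. P e}
    \<le> measure_pmf.prob (random_composition I c m) {e. Q e}"
proof -
  let ?C = "bounded_compositions I c m" and ?swap = "\<lambda>e. e \<circ> Transposition.transpose a b"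
  have "measure_pmf.prob (pmf_of_set ?C) {e. P e} * 1
    \<le> measure_pmf.prob (pmf_of_set ?C) {e. Q e} * 1"
  proof (rule prob_pmf_of_set_switching_le[where M = "\<lambda>_. {()}" and T = "\<lambda>e _. ?swap e"
        and R = "\<lambda>_. {()}"])
    show "?swap e \<in> ?C \<and> Q (?swap e) \<and> l \<in> {()}" if "e \<in> ?C" "P e" for e l
      using swap[OF that] that ab by (simp add: transpose_in_bounded_compositions)
    show "inj_on ?swap {e \<in> ?C. P e \<and> l \<in> {()}}" for l
      using inj_comp_transpose by (rule inj_on_subset) simp
  qed (use nonempty finite_bounded_compositions[OF finite_I] in auto)
  then show ?thesis by simp
qed

lemma prob_greater_near_half:
  assumes ab: "a \<in> I" "b \<in> I" and c: "c b \<le> c a"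
  shows "\<bar>measure_pmf.prob (random_composition I c m) {e. e b < e a} - 1 / 2\<bar>
    \<le> measure_pmf.prob (random_composition I c m) {e. c b \<le> e a}
      + measure_pmf.prob (random_composition I c m) {e. e a = e b}"
proof -
  let ?P = "measure_pmf.prob (random_composition I c m)"
  note entry_less = bounded_compositions_less[OF _ ab(2), of _ c m]
  have "?P {e. e a < e b} \<le> ?P {e. e b < e a}"
    using c by (intro prob_le_prob_transpose[OF ab]) (auto dest: entry_less)
  moreover have "?P {e. e b < e a} \<le> ?P {e. e a < e b} + ?P {e. c b \<le> e a}"
  proof -
    have "?P {e. e b < e a} \<le> ?P {e. e b < e a \<and> e a < c b} + ?P {e. c b \<le> e a}"
      by (intro prob_le_add) auto
    also have "?P {e. e b < e a \<and> e a < c b} \<le> ?P {e. e a < e b}"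
      using c by (intro prob_le_prob_transpose[OF ab]) (auto dest: entry_less)
    finally show ?thesis by simp
  qed
  moreover have "?P {e. e a < e b} + ?P {e. e b < e a} = 1 - ?P {e. e a = e b}"
  proof -
    have "?P {e. e a < e b} + ?P {e. e b < e a} = ?P ({e. e a < e b} \<union> {e. e b < e a})"
      by (intro measure_pmf.finite_measure_Union[symmetric]) auto
    also have "{e :: 'a \<Rightarrow> nat. e a < e b} \<union> {e. e b < e a} = UNIV - {e. e a = e b}"
      by auto
    also have "?P \<dots> = 1 - ?P {e. e a = e b}"
      using measure_pmf.prob_compl[of "{e. e a = e b}" "random_composition I c m"] by simp
    finally show ?thesis .
  qed
  moreover have "0 \<le> ?P {e. e a = e b}" by simp
  ultimately show ?thesis by linarith
qed

end

subsection \<open>Lehmer codes\<close>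

definition lehmer :: "nat \<Rightarrow> (nat \<Rightarrow> nat) \<Rightarrow> nat \<Rightarrow> nat" where
  "lehmer n \<sigma> = (\<lambda>i\<in>{1..n}. card {l \<in> {1..<i}. \<sigma> i < \<sigma> l})"

abbreviation codes :: "nat \<Rightarrow> nat \<Rightarrow> (nat \<Rightarrow> nat) set" where
  "codes n m \<equiv> bounded_compositions {1..n} (\<lambda>i. i) m"

abbreviation random_code :: "nat \<Rightarrow> nat \<Rightarrow> (nat \<Rightarrow> nat) pmf" where
  "random_code n m \<equiv> random_composition {1..n} (\<lambda>i. i) m"

lemma lehmer_in_PiE: "lehmer n \<sigma> \<in> (\<Pi>\<^sub>E i\<in>{1..n}. {..<i})"
proof (rule PiE_I)
  fix i assume i: "i \<in> {1..n}"
  have "card {l \<in> {1..<i}. \<sigma> i < \<sigma> l} \<le> card {1..<i}"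
    by (intro card_mono) auto
  then show "lehmer n \<sigma> i \<in> {..<i}"
    using i by (auto simp: lehmer_def)
qed (auto simp: lehmer_def)

lemma sum_lehmer: "sum (lehmer n \<sigma>) {1..n} = card (inversions n \<sigma>)"
proof -
  have "inversions n \<sigma> = prod.swap ` (SIGMA i:{1..n}. {l \<in> {1..<i}. \<sigma> i < \<sigma> l})"
    unfolding inversions_def by force
  then have "card (inversions n \<sigma>) = card (SIGMA i:{1..n}. {l \<in> {1..<i}. \<sigma> i < \<sigma> l})"
    by (simp add: card_image)
  also have "\<dots> = sum (lehmer n \<sigma>) {1..n}"
    by (subst card_SigmaI) (auto simp: lehmer_def)
  finally show ?thesis by simp
qed

lemma inj_on_card_greater:
  fixes S :: "'a::linorder set"
  assumes "finite S"
  shows "inj_on (\<lambda>y. card {x \<in> S. y < x}) S"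
proof (rule linorder_inj_onI')
  fix y z assume "y \<in> S" "z \<in> S" "y < z"
  then have "{x \<in> S. z < x} \<subset> {x \<in> S. y < x}" by auto
  then have "card {x \<in> S. z < x} < card {x \<in> S. y < x}"
    using assms by (intro psubset_card_mono) auto
  then show "card {x \<in> S. y < x} \<noteq> card {x \<in> S. z < x}" by simp
qed

lemma lehmer_eq_card_image:
  assumes "inj \<sigma>" "i \<in> {1..n}"
  shows "lehmer n \<sigma> i = card {x \<in> \<sigma> ` {1..i}. \<sigma> i < x}"
proof -
  have "{x \<in> \<sigma> ` {1..i}. \<sigma> i < x} = \<sigma> ` {l \<in> {1..<i}. \<sigma> i < \<sigma> l}"
    by (force simp: order.order_iff_strict)
  then show ?thesis
    using assms by (simp add: lehmer_def card_image inj_on_subset)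
qed

text \<open>
  A permutation is read off its code from right to left: position \<open>i\<close> takes one of the values
  not used further right, and the code counts the remaining values above it.
\<close>
lemma lehmer_eq_imp_eq:
  assumes perm: "\<sigma> permutes {1..n}" "\<tau> permutes {1..n}" and i: "i \<in> {1..n}"
    and right: "\<And>l. i < l \<Longrightarrow> \<sigma> l = \<tau> l" and code: "lehmer n \<sigma> i = lehmer n \<tau> i"
  shows "\<sigma> i = \<tau> i"
proof -
  have values_left: "\<pi> ` {1..i} = {1..n} - \<pi> ` {i<..n}" if "\<pi> permutes {1..n}" for \<pi>
  proof -
    have "{1..i} = {1..n} - {i<..n}" using i by auto
    then show ?thesis
      using permutes_inj[OF that] permutes_image[OF that] by (simp add: image_set_diff)
  qed
  have same_values: "\<sigma> ` {1..i} = \<tau> ` {1..i}"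
    unfolding values_left[OF perm(1)] values_left[OF perm(2)] using right by (auto simp: image_iff)
  show ?thesis
  proof (rule inj_onD[OF inj_on_card_greater])
    show "card {x \<in> \<tau> ` {1..i}. \<sigma> i < x} = card {x \<in> \<tau> ` {1..i}. \<tau> i < x}"
      using code lehmer_eq_card_image[OF permutes_inj[OF perm(1)] i]
        lehmer_eq_card_image[OF permutes_inj[OF perm(2)] i]
      unfolding same_values by simp
    show "\<sigma> i \<in> \<tau> ` {1..i}"
      unfolding same_values[symmetric] using i by auto
    show "\<tau> i \<in> \<tau> ` {1..i}"
      using i by auto
  qed simp
qed

lemma inj_on_lehmer: "inj_on (lehmer n) {\<sigma>. \<sigma> permutes {1..n}}"
proof (rule inj_onI)
  fix \<sigma> \<tau> assume "\<sigma> \<in> {\<sigma>. \<sigma> permutes {1..n}}" "\<tau> \<in> {\<sigma>. \<sigma> permutes {1..n}}"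
    and code: "lehmer n \<sigma> = lehmer n \<tau>"
  then have perm: "\<sigma> permutes {1..n}" "\<tau> permutes {1..n}" by auto
  have "\<forall>l>0. \<sigma> l = \<tau> l"
  proof (rule inc_induct)
    show "0 \<le> n" by simp
    show "\<forall>l>n. \<sigma> l = \<tau> l"
      using perm by (simp add: permutes_not_in)
  next
    fix i assume i: "i < n" and right: "\<forall>l>Suc i. \<sigma> l = \<tau> l"
    have "\<sigma> (Suc i) = \<tau> (Suc i)"
      by (rule lehmer_eq_imp_eq[OF perm]) (use i right code in auto)
    then show "\<forall>l>i. \<sigma> l = \<tau> l"
      using right by (metis Suc_lessI)
  qed
  moreover have "\<sigma> 0 = \<tau> 0"
    using perm by (simp add: permutes_not_in)
  ultimately show "\<sigma> = \<tau>" by (metis ext gr0I)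
qed

lemma lehmer_image_permutations: "lehmer n ` {\<sigma>. \<sigma> permutes {1..n}} = (\<Pi>\<^sub>E i\<in>{1..n}. {..<i})"
proof (rule card_subset_eq)
  show "card (lehmer n ` {\<sigma>. \<sigma> permutes {1..n}}) = card (\<Pi>\<^sub>E i\<in>{1..n}. {..<i})"
    by (simp add: card_image[OF inj_on_lehmer] card_permutations card_PiE fact_prod
        del: One_nat_def)
qed (use lehmer_in_PiE in \<open>auto intro: finite_PiE\<close>)

lemma bij_betw_lehmer: "bij_betw (lehmer n) (perms_inv n m) (codes n m)"
proof -
  have "perms_inv n m = {\<sigma> \<in> {\<sigma>. \<sigma> permutes {1..n}}. sum (lehmer n \<sigma>) {1..n} = m}"
    by (simp only: perms_inv_def sum_lehmer mem_Collect_eq)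
  moreover have "codes n m = {e \<in> lehmer n ` {\<sigma>. \<sigma> permutes {1..n}}. sum e {1..n} = m}"
    unfolding lehmer_image_permutations by (simp add: bounded_compositions_def)
  moreover have "inj_on (lehmer n) (perms_inv n m)"
    by (rule inj_on_subset[OF inj_on_lehmer]) (auto simp: perms_inv_def)
  ultimately show ?thesis
    by (auto simp: bij_betw_def)
qed

lemma finite_perms_inv: "finite (perms_inv n m)"
  unfolding perms_inv_def by (rule finite_subset[OF _ finite_permutations[of "{1..n}"]]) auto

lemma codes_empty_iff: "codes n m = {} \<longleftrightarrow> perms_inv n m = {}"
  using bij_betw_lehmer[of n m] by (auto simp: bij_betw_def)

lemma prob_random_perm_lehmer:
  assumes "perms_inv n m \<noteq> {}"
  shows "measure_pmf.prob (random_perm n m) {\<sigma>. Q (lehmer n \<sigma>)}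
    = measure_pmf.prob (random_code n m) {e. Q e}"
  unfolding random_perm_def
  using bij_betw_lehmer assms finite_perms_inv by (rule prob_pmf_of_set_bij_betw)

lemma set_random_perm: "perms_inv n m \<noteq> {} \<Longrightarrow> set_pmf (random_perm n m) = perms_inv n m"
  unfolding random_perm_def using finite_perms_inv by (rule set_pmf_of_set[rotated])

lemma inversion_imp_lehmer_less:
  assumes "0 < i" "i < j" "j \<le> n" "\<sigma> j < \<sigma> i"
  shows "lehmer n \<sigma> i < lehmer n \<sigma> j"
proof -
  have "{l \<in> {1..<i}. \<sigma> i < \<sigma> l} \<subseteq> {l \<in> {1..<j}. \<sigma> j < \<sigma> l}"
    using assms by auto
  moreover have "i \<in> {l \<in> {1..<j}. \<sigma> j < \<sigma> l} - {l \<in> {1..<i}. \<sigma> i < \<sigma> l}"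
    using assms by simp
  ultimately have "{l \<in> {1..<i}. \<sigma> i < \<sigma> l} \<subset> {l \<in> {1..<j}. \<sigma> j < \<sigma> l}" by blast
  then show ?thesis
    using assms by (auto simp: lehmer_def intro!: psubset_card_mono)
qed

lemma lehmer_add_le_imp_inversion:
  assumes "0 < i" "i < j" "j \<le> n" "lehmer n \<sigma> i + (j - i) \<le> lehmer n \<sigma> j"
  shows "\<sigma> j < \<sigma> i"
proof (rule ccontr)
  assume "\<not> \<sigma> j < \<sigma> i"
  have "l \<in> {l \<in> {1..<i}. \<sigma> i < \<sigma> l} \<union> {i<..<j}" if l: "l \<in> {l \<in> {1..<j}. \<sigma> j < \<sigma> l}" for l
  proof -
    have "\<sigma> i < \<sigma> l" using l \<open>\<not> \<sigma> j < \<sigma> i\<close> by simp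
    then have "l \<noteq> i" by blast
    then show ?thesis using l \<open>\<sigma> i < \<sigma> l\<close> by auto
  qed
  then have "{l \<in> {1..<j}. \<sigma> j < \<sigma> l} \<subseteq> {l \<in> {1..<i}. \<sigma> i < \<sigma> l} \<union> {i<..<j}"
    by (rule subsetI)
  then have "card {l \<in> {1..<j}. \<sigma> j < \<sigma> l} \<le> card ({l \<in> {1..<i}. \<sigma> i < \<sigma> l} \<union> {i<..<j})"
    by (intro card_mono) auto
  also have "\<dots> \<le> card {l \<in> {1..<i}. \<sigma> i < \<sigma> l} + card {i<..<j}"
    by (rule card_Un_le)
  finally have "lehmer n \<sigma> j \<le> lehmer n \<sigma> i + (j - i - 1)"
    using assms by (simp add: lehmer_def)
  then show False using assms by linarith
qed

subsection \<open>Reverse-complement\<close>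

definition reflect :: "nat \<Rightarrow> nat \<Rightarrow> nat" where
  "reflect n i = (if i \<in> {1..n} then n + 1 - i else i)"

definition revcomp :: "nat \<Rightarrow> (nat \<Rightarrow> nat) \<Rightarrow> nat \<Rightarrow> nat" where
  "revcomp n \<sigma> = reflect n \<circ> \<sigma> \<circ> reflect n"

lemma reflect_reflect [simp]: "reflect n (reflect n i) = i"
  by (auto simp: reflect_def)

lemma reflect_in_iff [simp]: "reflect n i \<in> {1..n} \<longleftrightarrow> i \<in> {1..n}"
  by (auto simp: reflect_def)

lemma reflect_less_iff: "i \<in> {1..n} \<Longrightarrow> j \<in> {1..n} \<Longrightarrow> reflect n i < reflect n j \<longleftrightarrow> j < i"
  by (auto simp: reflect_def)

lemma reflect_permutes: "reflect n permutes {1..n}"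
  by (rule bij_imp_permutes)
    (auto simp: reflect_def intro!: bij_betw_byWitness[where f' = "reflect n"])

lemma revcomp_revcomp [simp]: "revcomp n (revcomp n \<sigma>) = \<sigma>"
  by (simp add: revcomp_def fun_eq_iff)

lemma revcomp_permutes: "\<sigma> permutes {1..n} \<Longrightarrow> revcomp n \<sigma> permutes {1..n}"
  unfolding revcomp_def by (intro permutes_compose reflect_permutes)

lemma revcomp_less_iff:
  assumes "\<sigma> permutes {1..n}" "i \<in> {1..n}" "j \<in> {1..n}"
  shows "revcomp n \<sigma> i < revcomp n \<sigma> j \<longleftrightarrow> \<sigma> (reflect n j) < \<sigma> (reflect n i)"
  using assms
  by (simp only: revcomp_def comp_apply reflect_less_iff permutes_in_image reflect_in_iff)

lemma card_inversions_revcomp: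
  assumes "\<sigma> permutes {1..n}"
  shows "card (inversions n (revcomp n \<sigma>)) = card (inversions n \<sigma>)"
proof (rule bij_betw_same_card)
  show "bij_betw (\<lambda>(i, j). (reflect n j, reflect n i))
      (inversions n (revcomp n \<sigma>)) (inversions n \<sigma>)"
    using assms
    by (intro bij_betw_byWitness[where f' = "\<lambda>(i, j). (reflect n j, reflect n i)"])
      (auto simp: inversions_def revcomp_less_iff reflect_less_iff
        simp del: atLeastAtMost_iff One_nat_def)
qed

lemma bij_betw_revcomp: "bij_betw (revcomp n) (perms_inv n m) (perms_inv n m)"
  by (rule bij_betw_byWitness[where f' = "revcomp n"])
    (auto simp: perms_inv_def revcomp_permutes card_inversions_revcomp simp del: One_nat_def)

lemma prob_random_perm_revcomp:
  assumes "perms_inv n m \<noteq> {}"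
  shows "measure_pmf.prob (random_perm n m) {\<sigma>. Q (revcomp n \<sigma>)}
    = measure_pmf.prob (random_perm n m) {\<sigma>. Q \<sigma>}"
  unfolding random_perm_def
  using bij_betw_revcomp assms finite_perms_inv by (rule prob_pmf_of_set_bij_betw)

lemma lehmer_revcomp:
  assumes "\<sigma> permutes {1..n}" "i \<in> {1..n}"
  shows "lehmer n (revcomp n \<sigma>) (reflect n i) = card {l \<in> {i<..n}. \<sigma> l < \<sigma> i}"
proof -
  have "l \<in> {1..<reflect n i} \<and> revcomp n \<sigma> (reflect n i) < revcomp n \<sigma> l
      \<longleftrightarrow> reflect n l \<in> {i<..n} \<and> \<sigma> (reflect n l) < \<sigma> i" for l
  proof (rule conj_cong)
    show left_iff_right: "l \<in> {1..<reflect n i} \<longleftrightarrow> reflect n l \<in> {i<..n}"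
      using assms(2) by (auto simp: reflect_def)
    assume "reflect n l \<in> {i<..n}"
    then have "l \<in> {1..n}"
      using left_iff_right reflect_in_iff[of n i] assms(2) by fastforce
    then show "revcomp n \<sigma> (reflect n i) < revcomp n \<sigma> l \<longleftrightarrow> \<sigma> (reflect n l) < \<sigma> i"
      using assms by (simp only: revcomp_less_iff reflect_in_iff reflect_reflect)
  qed
  then have "{l \<in> {1..<reflect n i}. revcomp n \<sigma> (reflect n i) < revcomp n \<sigma> l}
      = reflect n -` {l \<in> {i<..n}. \<sigma> l < \<sigma> i}"
    by blast
  moreover have "card (reflect n -` {l \<in> {i<..n}. \<sigma> l < \<sigma> i}) = card {l \<in> {i<..n}. \<sigma> l < \<sigma> i}"
    using permutes_inj[OF reflect_permutes] permutes_surj[OF reflect_permutes]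
    by (intro card_vimage_inj) auto
  ultimately show ?thesis
    using assms(2) by (simp only: lehmer_def restrict_apply' reflect_in_iff)
qed

lemma inversion_imp_lehmer_sum_gt:
  assumes "\<sigma> permutes {1..n}" "0 < i" "i < j" "j \<le> n" "\<sigma> j < \<sigma> i"
  shows "j - i < lehmer n \<sigma> j + lehmer n (revcomp n \<sigma>) (reflect n i)"
proof -
  let ?L = "{l \<in> {1..<j}. \<sigma> j < \<sigma> l}" and ?R = "{l \<in> {i<..n}. \<sigma> l < \<sigma> i}"
  have "l \<in> (?L - {i}) \<union> (?R - {j})" if l: "l \<in> {i<..<j}" for l
  proof -
    have "\<sigma> l \<noteq> \<sigma> j"
      using l permutes_inj[OF assms(1)] by (auto dest: injD)
    then show ?thesis using l assms by auto
  qed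
  then have "{i<..<j} \<subseteq> (?L - {i}) \<union> (?R - {j})"
    by (rule subsetI)
  then have "card {i<..<j} \<le> card ((?L - {i}) \<union> (?R - {j}))"
    by (intro card_mono) simp_all
  also have "\<dots> \<le> card (?L - {i}) + card (?R - {j})" by (rule card_Un_le)
  finally have "j - i - 1 \<le> card (?L - {i}) + card (?R - {j})" by simp
  moreover have "card ?L = Suc (card (?L - {i}))" "card ?R = Suc (card (?R - {j}))"
    using assms by (intro card.remove; simp)+
  moreover have "lehmer n \<sigma> j = card ?L"
    using assms by (simp add: lehmer_def)
  moreover have "lehmer n (revcomp n \<sigma>) (reflect n i) = card ?R"
    using assms by (intro lehmer_revcomp) auto
  ultimately show ?thesis by linarith
qed

subsection \<open>The probability of an inversion\<close>

definition inversion_prob :: "nat \<Rightarrow> nat \<Rightarrow> nat \<Rightarrow> nat \<Rightarrow> real" where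
  "inversion_prob n m i j = measure_pmf.prob (random_perm n m) {\<sigma>. \<sigma> j < \<sigma> i}"

lemma prob_code_entry_ge_le:
  assumes ne: "perms_inv n m \<noteq> {}" and i: "i \<in> {1..n}" and t: "0 < t" "4 * t \<le> n + 2"
  shows "measure_pmf.prob (random_code n m) {e. t \<le> e i}
    \<le> 4 * (real m / real n) / real t"
proof -
  let ?p = "measure_pmf.prob (random_code n m) {e. t \<le> e i}"
  have pos: "0 < real n" "0 < real t" using i t by auto
  have "{b \<in> {1..n}. 2 * t \<le> b} = {2 * t..n}" using t by auto
  then have "n / 2 \<le> card {b \<in> {1..n}. 2 * t \<le> b}" using t by auto
  then have "t * (real n / 2) - m \<le> t * real (card {b \<in> {1..n}. 2 * t \<le> b}) - m"
    by (intro diff_right_mono mult_left_mono) auto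
  then have "?p * (t * (real n / 2) - m) \<le> ?p * (t * real (card {b \<in> {1..n}. 2 * t \<le> b}) - m)"
    by (rule mult_left_mono) simp
  also have "\<dots> \<le> m"
    using ne[folded codes_empty_iff] i t by (intro prob_entry_ge_mult_le) auto
  finally have switching: "?p * (t * (real n / 2) - m) \<le> m" .
  have "?p * (t * real n) \<le> 4 * m"
  proof (cases "t * real n \<le> 4 * m")
    case True
    have "?p * (t * real n) \<le> 1 * (t * real n)"
      by (intro mult_right_mono) auto
    then show ?thesis using True by simp
  next
    case False
    then have "t * real n / 4 \<le> t * (real n / 2) - m"
      by (simp add: algebra_simps)
    then have "?p * (t * real n / 4) \<le> ?p * (t * (real n / 2) - m)"
      by (rule mult_left_mono) simp
    then show ?thesis using switching by simp
  qed
  then show ?thesis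
    using pos by (simp add: field_simps)
qed

lemma prob_code_entries_close_le:
  assumes ne: "perms_inv n m \<noteq> {}" and m: "0 < m" and n: "4 \<le> n" and a: "a \<in> {1..n}" "n \<le> 2 * a"
    and b: "b \<in> {1..n}" "a \<noteq> b" and k: "0 < k"
  shows "measure_pmf.prob (random_code n m) {e. e a < n div 4 \<and> \<bar>int (e a) - int (e b)\<bar> < int k}
    \<le> 32 * (real k / (real m / real n))"
proof -
  let ?h = "n div 4"
  let ?p = "measure_pmf.prob (random_code n m) {e. e a < ?h \<and> \<bar>int (e a) - int (e b)\<bar> < int k}"
  have "?p * (real m * n) \<le> 32 * k * real n * n"
  proof (cases "m < 4 * n")
    case True
    have "real m \<le> 4 * real n" using True by simp
    also have "\<dots> \<le> 4 * k * real n" using k by (intro mult_right_mono) auto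
    finally have "?p * (real m * n) \<le> 1 * (4 * k * real n * n)"
      by (intro mult_mono) auto
    also have "\<dots> \<le> 32 * k * real n * n"
      unfolding mult_1 by (intro mult_right_mono) auto
    finally show ?thesis .
  next
    case False
    have "n \<le> 8 * ?h" using n by presburger
    then have "real n / 8 * (real m / 2) \<le> ?h * (real m - 2 * real n)"
      using False by (intro mult_mono) auto
    then have "?p * (real n / 8 * (real m / 2)) \<le> ?p * (?h * (real m - 2 * real n))"
      by (rule mult_left_mono) simp
    also have "\<dots> \<le> 2 * real k * real (card {1..n}) * real n"
      using ne[folded codes_empty_iff] a b by (intro prob_entries_close_mult_le) auto
    finally show ?thesis by (simp add: mult_ac)
  qed
  then show ?thesis
    using m n by (simp add: field_simps)
qed

lemma inversion_prob_le_code: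
  assumes "perms_inv n m \<noteq> {}" "0 < i" "i < j" "j \<le> n"
  shows "inversion_prob n m i j \<le> measure_pmf.prob (random_code n m) {e. e i < e j}"
  unfolding inversion_prob_def prob_random_perm_lehmer[OF assms(1), symmetric]
  using assms inversion_imp_lehmer_less by (intro prob_mono_on_set_pmf) auto

lemma code_le_inversion_prob:
  assumes "perms_inv n m \<noteq> {}" "0 < i" "i < j" "j \<le> n"
  shows "measure_pmf.prob (random_code n m) {e. e i + (j - i) \<le> e j} \<le> inversion_prob n m i j"
  unfolding inversion_prob_def prob_random_perm_lehmer[OF assms(1), symmetric]
  using assms lehmer_add_le_imp_inversion by (intro prob_mono_on_set_pmf) auto

lemma inversion_prob_reflect:
  assumes "perms_inv n m \<noteq> {}" "i \<in> {1..n}" "j \<in> {1..n}"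
  shows "inversion_prob n m (reflect n j) (reflect n i) = inversion_prob n m i j"
proof -
  have "measure_pmf.prob (random_perm n m) {\<sigma>. \<sigma> j < \<sigma> i}
      = measure_pmf.prob (random_perm n m)
          {\<sigma>. revcomp n \<sigma> (reflect n i) < revcomp n \<sigma> (reflect n j)}"
    using assms
    by (intro antisym prob_mono_on_set_pmf)
      (auto simp: set_random_perm perms_inv_def revcomp_less_iff
        simp del: atLeastAtMost_iff One_nat_def)
  then show ?thesis
    unfolding inversion_prob_def
    by (simp add: prob_random_perm_revcomp[OF assms(1), of "\<lambda>\<sigma>. \<sigma> (reflect n i) < \<sigma> (reflect n j)"])
qed

lemma inversion_prob_le:
  assumes ne: "perms_inv n m \<noteq> {}" and ij: "0 < i" "i < j" "j \<le> n"
  shows "inversion_prob n m i j \<le> 32 * ((real m / real n) / real (j - i))"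
proof -
  define t where "t = (j - i + 3) div 4"
  have t: "0 < t" "4 * t \<le> n + 2" "2 * t \<le> j - i + 1" "real (j - i) / 4 \<le> t"
    using ij unfolding t_def by linarith+
  let ?P = "measure_pmf.prob (random_perm n m)"
  have "inversion_prob n m i j
      \<le> ?P {\<sigma>. t \<le> lehmer n \<sigma> j \<or> t \<le> lehmer n (revcomp n \<sigma>) (reflect n i)}"
    unfolding inversion_prob_def
  proof (rule prob_mono_on_set_pmf)
    fix \<sigma> assume "\<sigma> \<in> set_pmf (random_perm n m)" "\<sigma> j < \<sigma> i"
    then have "j - i < lehmer n \<sigma> j + lehmer n (revcomp n \<sigma>) (reflect n i)"
      using ij ne by (intro inversion_imp_lehmer_sum_gt) (auto simp: set_random_perm perms_inv_def)
    then show "t \<le> lehmer n \<sigma> j \<or> t \<le> lehmer n (revcomp n \<sigma>) (reflect n i)"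
      using t by linarith
  qed
  also have "\<dots> \<le> ?P {\<sigma>. t \<le> lehmer n \<sigma> j} + ?P {\<sigma>. t \<le> lehmer n (revcomp n \<sigma>) (reflect n i)}"
    by (rule prob_le_add)
  also have "\<dots> = measure_pmf.prob (random_code n m) {e. t \<le> e j}
      + measure_pmf.prob (random_code n m) {e. t \<le> e (reflect n i)}"
    by (simp only: prob_random_perm_lehmer[OF ne, of "\<lambda>e. t \<le> e _"]
        prob_random_perm_revcomp[OF ne, of "\<lambda>\<sigma>. t \<le> lehmer n \<sigma> (reflect n i)"])
  also have "\<dots> \<le> 4 * (m / n) / t + 4 * (m / n) / t"
    using ij t by (intro add_mono prob_code_entry_ge_le ne) (auto simp: reflect_def)
  also have "\<dots> = 8 * (m / n) / t" by simp
  also have "\<dots> \<le> 8 * (m / n) / (real (j - i) / 4)"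
    using ij t by (intro divide_left_mono mult_pos_pos) auto
  finally show ?thesis by simp
qed

lemma inversion_prob_near_half_right:
  assumes ne: "perms_inv n m \<noteq> {}" and m: "0 < m" and ij: "0 < i" "i < j" "j \<le> n"
    and close: "4 * (j - i) \<le> n" and right: "n \<le> i + j"
  shows "\<bar>inversion_prob n m i j - 1 / 2\<bar>
    \<le> 96 * (real m / (real n)\<^sup>2) + 64 * (real (j - i) / (real m / real n))"
proof -
  let ?P = "measure_pmf.prob (random_code n m)" and ?h = "n div 4"
  let ?close = "\<lambda>e::nat \<Rightarrow> nat. \<bar>int (e j) - int (e i)\<bar> < int (j - i)"
  let ?large = "?P {e. ?h \<le> e j}"
  have n: "4 \<le> n" using ij close by linarith
  have "?P {e. e i < e j} \<le> ?P {e. e i + (j - i) \<le> e j} + ?P {e. ?close e}"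
    by (rule prob_le_add) linarith
  then have "\<bar>inversion_prob n m i j - ?P {e. e i < e j}\<bar> \<le> ?P {e. ?close e}"
    using inversion_prob_le_code[OF ne ij] code_le_inversion_prob[OF ne ij] by linarith
  moreover have "\<bar>?P {e. e i < e j} - 1 / 2\<bar> \<le> ?P {e. i \<le> e j} + ?P {e. e j = e i}"
    using ne[folded codes_empty_iff] ij by (intro prob_greater_near_half) auto
  moreover have "?P {e. i \<le> e j} \<le> ?large"
    using close right by (intro prob_mono_on_set_pmf) linarith
  moreover have "?P {e. e j = e i} \<le> ?P {e. ?close e}"
    using ij by (intro prob_mono_on_set_pmf) simp
  moreover have "?P {e. ?close e} \<le> ?P {e. e j < ?h \<and> ?close e} + ?large"
    by (rule prob_le_add) linarith
  moreover have "?P {e. e j < ?h \<and> ?close e} \<le> 32 * (real (j - i) / (m / n))"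
    using ne m n ij right by (intro prob_code_entries_close_le) auto
  moreover have "?large \<le> 32 * (m / (real n)\<^sup>2)"
  proof -
    have "n \<le> 8 * ?h" using n by presburger
    have "?large \<le> 4 * (m / n) / ?h"
      using ne n ij by (intro prob_code_entry_ge_le) auto
    also have "\<dots> \<le> 4 * (m / n) / (n / 8)"
      using n \<open>n \<le> 8 * ?h\<close> by (intro divide_left_mono mult_pos_pos) auto
    finally show ?thesis by (simp add: power2_eq_square)
  qed
  ultimately show ?thesis by linarith
qed

lemma inversion_prob_near_half:
  assumes ne: "perms_inv n m \<noteq> {}" and m: "0 < m" and ij: "0 < i" "i < j" "j \<le> n"
  shows "\<bar>inversion_prob n m i j - 1 / 2\<bar>
    \<le> 96 * (real m / (real n)\<^sup>2) + 64 * (real (j - i) / (real m / real n))"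
proof (cases "4 * (j - i) \<le> n")
  case close: True
  show ?thesis
  proof (cases "n \<le> i + j")
    case True
    then show ?thesis
      using inversion_prob_near_half_right[OF ne m ij close] by simp
  next
    case False
    then have "reflect n i - reflect n j = j - i" "0 < reflect n j" "reflect n j < reflect n i"
      "reflect n i \<le> n" "n \<le> reflect n j + reflect n i"
      using ij by (auto simp: reflect_def)
    then show ?thesis
      using inversion_prob_near_half_right[OF ne m, of "reflect n j" "reflect n i"] close ij
      by (simp add: inversion_prob_reflect[OF ne])
  qed
next
  case False
  let ?x = "m / (real n)\<^sup>2" and ?y = "real (j - i) / (m / n)"
  have "1 / 4 < real (j - i) / n"
    using False ij by (simp add: field_simps)
  also have "real (j - i) / n = ?x * ?y"
    using m by (simp add: power2_eq_square)
  finally have "1 / 2 < ?x \<or> 1 / 2 < ?y"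
    using mult_mono[of ?x "1 / 2" ?y "1 / 2"] by fastforce
  moreover have "0 \<le> ?x" "0 \<le> ?y" by auto
  moreover have "0 \<le> inversion_prob n m i j" "inversion_prob n m i j \<le> 1"
    by (simp_all add: inversion_prob_def)
  ultimately show ?thesis by linarith
qed

subsection \<open>The limit\<close>

lemma much_less_mono:
  assumes "f \<lless> g" and "\<forall>\<^sub>F n in sequentially. 0 < g n \<and> g n \<le> h n"
  shows "f \<lless> h"
  unfolding much_less_def
proof (rule Lim_null_comparison)
  show "(\<lambda>n. \<bar>f n / g n\<bar>) \<longlonglongrightarrow> 0"
    using assms(1) unfolding much_less_def by (rule tendsto_rabs_zero)
  show "\<forall>\<^sub>F n in sequentially. norm (f n / h n) \<le> \<bar>f n / g n\<bar>"
    using assms(2) by eventually_elim (auto simp: abs_divide intro!: divide_left_mono)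
qed

lemma much_less_square_of_div_ln:
  assumes "f \<lless> (\<lambda>n. (real n)\<^sup>2 / (ln (real n))\<^sup>2)"
  shows "f \<lless> (\<lambda>n. (real n)\<^sup>2)"
  using assms
proof (rule much_less_mono)
  show "\<forall>\<^sub>F n in sequentially. 0 < (real n)\<^sup>2 / (ln (real n))\<^sup>2
      \<and> (real n)\<^sup>2 / (ln (real n))\<^sup>2 \<le> (real n)\<^sup>2"
    using eventually_ge_at_top[of 3]
  proof eventually_elim
    case (elim n)
    then have "1 \<le> ln (real n)"
      using exp_le by (subst ln_ge_iff) auto
    moreover from this have "(real n)\<^sup>2 / (ln (real n))\<^sup>2 \<le> (real n)\<^sup>2 / 1"
      by (intro divide_left_mono) (auto simp: one_le_power)
    ultimately show ?case using elim by simp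
  qed
qed

lemma perms_inv_nonempty:
  assumes "m \<le> (\<Sum>i\<in>{1..n}. i - 1)"
  shows "perms_inv n m \<noteq> {}"
  unfolding codes_empty_iff[symmetric] using assms by (intro bounded_compositions_nonempty) auto

lemma eventually_perms_inv_nonempty:
  assumes "(\<lambda>n. real (m n)) \<lless> (\<lambda>n. (real n)\<^sup>2)"
  shows "\<forall>\<^sub>F n in sequentially. perms_inv n (m n) \<noteq> {}"
proof -
  have triangle: "2 * (\<Sum>i\<in>{1..n}. i - 1) = n * (n - 1)" for n :: nat
    by (induction n) (auto simp: algebra_simps)
  have "\<forall>\<^sub>F n in sequentially. m n / (real n)\<^sup>2 < 1 / 4"
    using assms unfolding much_less_def by (rule order_tendstoD) simp
  then show ?thesis
    using eventually_ge_at_top[of 2]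
  proof eventually_elim
    case (elim n)
    then have "real (4 * m n) \<le> real (n * n)"
      by (simp add: field_simps power2_eq_square)
    then have "4 * m n \<le> n * n"
      by (simp only: of_nat_le_iff)
    also have "\<dots> \<le> n * (2 * (n - 1))"
      using elim by (intro mult_left_mono) auto
    finally show ?case
      using triangle[of n] by (intro perms_inv_nonempty) linarith
  qed
qed

lemma inversion_prob_tendsto_half:
  assumes positions: "\<forall>\<^sub>F n in sequentially. 0 < i n \<and> i n < j n \<and> j n \<le> n"
    and m_pos: "\<forall>\<^sub>F n in sequentially. 0 < m n"
    and m_small: "(\<lambda>n. real (m n)) \<lless> (\<lambda>n. (real n)\<^sup>2)"
    and near: "(\<lambda>n. real (j n - i n)) \<lless> (\<lambda>n. real (m n) / real n)"
  shows "(\<lambda>n. inversion_prob n (m n) (i n) (j n)) \<longlonglongrightarrow> 1 / 2"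
proof (rule LIM_zero_cancel, rule Lim_null_comparison)
  show "\<forall>\<^sub>F n in sequentially. norm (inversion_prob n (m n) (i n) (j n) - 1 / 2)
      \<le> 96 * (m n / (real n)\<^sup>2) + 64 * (real (j n - i n) / (m n / n))"
    using positions m_pos eventually_perms_inv_nonempty[OF m_small]
    by eventually_elim (unfold real_norm_def, blast intro: inversion_prob_near_half)
  show "(\<lambda>n. 96 * (m n / (real n)\<^sup>2) + 64 * (real (j n - i n) / (m n / n))) \<longlonglongrightarrow> 0"
    using m_small near unfolding much_less_def
    by (intro tendsto_add_zero tendsto_mult_right_zero)
qed

lemma inversion_prob_tendsto_zero:
  assumes positions: "\<forall>\<^sub>F n in sequentially. 0 < i n \<and> i n < j n \<and> j n \<le> n"
    and m_small: "(\<lambda>n. real (m n)) \<lless> (\<lambda>n. (real n)\<^sup>2)"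
    and far: "(\<lambda>n. real (m n) / real n) \<lless> (\<lambda>n. real (j n - i n))"
  shows "(\<lambda>n. inversion_prob n (m n) (i n) (j n)) \<longlonglongrightarrow> 0"
proof (rule Lim_null_comparison)
  show "\<forall>\<^sub>F n in sequentially. norm (inversion_prob n (m n) (i n) (j n))
      \<le> 32 * ((m n / n) / real (j n - i n))"
    using positions eventually_perms_inv_nonempty[OF m_small]
  proof eventually_elim
    case (elim n)
    then show ?case
      using inversion_prob_le[of n "m n" "i n" "j n"] by (simp add: inversion_prob_def)
  qed
  show "(\<lambda>n. 32 * ((m n / n) / real (j n - i n))) \<longlonglongrightarrow> 0"
    using far unfolding much_less_def by (rule tendsto_mult_right_zero)
qed

theorem theorem4:
  fixes m k j :: "nat \<Rightarrow> nat"
  assumes m_pos: "\<And>n. m n > 0"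
    and k_pos: "\<And>n. k n > 0"
    and j_pos: "\<And>n. j n > 0"
    and m_lower: "(\<lambda>n. real n) \<lless> (\<lambda>n. real (m n))"
    and m_upper: "(\<lambda>n. real (m n)) \<lless> (\<lambda>n. (real n)\<^sup>2 / (ln (real n))\<^sup>2)"
    and j_le: "eventually (\<lambda>n. int (j n) \<le> int n - int (k n)) sequentially"
  shows "((\<lambda>n. real (k n)) \<lless> (\<lambda>n. real (m n) / real n) \<longrightarrow>
           (\<lambda>n. measure_pmf.prob (random_perm n (m n)) {\<sigma>. \<sigma> (j n) > \<sigma> (j n + k n)})
             \<longlonglongrightarrow> 1 / 2) \<and>
         ((\<lambda>n. real (m n) / real n) \<lless> (\<lambda>n. real (k n)) \<longrightarrow>
           (\<lambda>n. measure_pmf.prob (random_perm n (m n)) {\<sigma>. \<sigma> (j n) > \<sigma> (j n + k n)})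
             \<longlonglongrightarrow> 0)"
proof (intro conjI impI)
  let ?prob = "\<lambda>n. measure_pmf.prob (random_perm n (m n)) {\<sigma>. \<sigma> (j n) > \<sigma> (j n + k n)}"
  have m_small: "(\<lambda>n. real (m n)) \<lless> (\<lambda>n. (real n)\<^sup>2)"
    using m_upper by (rule much_less_square_of_div_ln)
  have positions: "\<forall>\<^sub>F n in sequentially. 0 < j n \<and> j n < j n + k n \<and> j n + k n \<le> n"
    using j_le by eventually_elim (use j_pos k_pos in auto)
  show "?prob \<longlonglongrightarrow> 1 / 2" if "(\<lambda>n. real (k n)) \<lless> (\<lambda>n. real (m n) / real n)"
    using inversion_prob_tendsto_half[OF positions _ m_small] that m_pos
    by (simp add: inversion_prob_def)
  show "?prob \<longlonglongrightarrow> 0" if "(\<lambda>n. real (m n) / real n) \<lless> (\<lambda>n. real (k n))"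
    using inversion_prob_tendsto_zero[OF positions m_small] that
    by (simp add: inversion_prob_def)
qed

end
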